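(* Let $A$ be a measurable set in $\mathbb{R}^n$. The following are equivalent: (a) For any $\varepsilon>0$ there exists $\delta>0$ such that $|D(Q)-D(Q')|\le\varepsilon$ for any pair of consecutive dyadic cubes $Q,Q'$ of the same sidelength $l(Q)=l(Q')<\delta$. (b) For any $\varepsilon>0$ there exists $\delta>0$ such that $|D(Q)-D(Q')|\le\varepsilon$ for any pair of consecutive cubes $Q,Q'$, with sides not necessarily parallel to the coordinate axes, of the same sidelength $l(Q)=l(Q')<\delta$. (c) $A$ is a smooth set.
   Context: $|\cdot|$ denotes Lebesgue measure in $\mathbb{R}^n$. Unless otherwise stated (as in (b)), a cube means a cube in $\mathbb{R}^n$ with sides parallel to the coordinate axes; $l(Q)$ is the sidelength of a cube $Q$. Dyadic cubes are the cubes $\prod_{i=1}^n[m_i2^{-k},(m_i+1)2^{-k})$ with $k,m_i\in\mathbb{Z}$. Two cubes $Q,Q'$ with $l(Q)=l(Q')$ are called consecutive if the intersection of their closures is one of their ($(n-1)$-dimensional) faces. The density of the measurable set $A$ in a cube $Q$ is $D(Q)=|A\cap Q|/|Q|$. A measurable set $A\subset\mathbb{R}^n$ is called smooth (in $\mathbb{R}^n$) if $$\lim_{\delta\to 0}\ \sup|D(Q)-D(Q')|=0,$$ where the supremum is taken over all pairs of consecutive (axis-parallel) cubes $Q,Q'$ with $l(Q)=l(Q')\le\delta$. *)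

theory Defs
  imports "HOL-Analysis.Analysis"
begin

text \<open>
  The families of cubes below are indexed by the sidelength. Except for dyadic cubes, which are
  half-open, nothing is prescribed about which boundary points belong to a cube.
\<close>

definition axis_cubes :: "real \<Rightarrow> (real ^ 'n) set set" where
  "axis_cubes l = {Q. l > 0 \<and> (\<exists>a. box a (a + vec l) \<subseteq> Q \<and> Q \<subseteq> cbox a (a + vec l))}"

text \<open>Translations are already accounted for by the corner in \<^const>\<open>axis_cubes\<close>.\<close>

definition all_cubes :: "real \<Rightarrow> (real ^ 'n) set set" where
  "all_cubes l = {f ` Q | (f :: real ^ 'n \<Rightarrow> real ^ 'n) Q. orthogonal_transformation f \<and> Q \<in> axis_cubes l}"

definition dyadic_cubes :: "real \<Rightarrow> (real ^ 'n) set set" where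
  "dyadic_cubes l =
     {{x. \<forall>i. of_int (m i) * 2 powi (- k) \<le> x $ i \<and> x $ i < (of_int (m i) + 1) * 2 powi (- k)}
       | (k :: int) (m :: 'n \<Rightarrow> int). l = 2 powi (- k)}"

text \<open>Only meant for two cubes of the same sidelength.\<close>

definition consecutive :: "(real ^ 'n) set \<Rightarrow> (real ^ 'n) set \<Rightarrow> bool" where
  "consecutive Q Q' \<longleftrightarrow>
     (closure Q \<inter> closure Q') facet_of closure Q \<and>
     (closure Q \<inter> closure Q') facet_of closure Q'"

definition density_in :: "(real ^ 'n) set \<Rightarrow> (real ^ 'n) set \<Rightarrow> real" where
  "density_in A Q = measure lebesgue (A \<inter> Q) / measure lebesgue Q"

text \<open>
  For \<open>\<delta> > 0\<close> the supremum is over a nonempty set of numbers in \<open>[0, 1]\<close>, so the real-valued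
  supremum is the genuine one.
\<close>

definition smooth_set :: "(real ^ 'n) set \<Rightarrow> bool" where
  "smooth_set A \<longleftrightarrow>
     A \<in> sets lebesgue \<and>
     ((\<lambda>\<delta>. SUP (Q, Q') \<in> {(Q, Q'). \<exists>l\<le>\<delta>. Q \<in> axis_cubes l \<and> Q' \<in> axis_cubes l \<and> consecutive Q Q'}.
          \<bar>density_in A Q - density_in A Q'\<bar>) \<longlongrightarrow> 0) (at_right 0)"

end

theory Submission
  imports Defs
begin

text \<open>
  Only the implication from (a) to (b) has content. Fix a large \<open>M\<close> and let \<open>Q\<close>, \<open>Q'\<close> be consecutive
  cubes of sidelength \<open>l\<close> in any position, with a common point \<open>z\<close> of their closures. Take dyadic
  cells of sidelength \<open>h\<close> comparable to \<open>l / M\<close>. Any cell inside \<open>Q\<close> or \<open>Q'\<close> is joined to the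
  cell containing \<open>z\<close> by a chain of \<open>O(M)\<close> consecutive dyadic cells, so for small \<open>l\<close> all these cells
  have density close to that of the cell of \<open>z\<close>. The density of \<open>A\<close> in \<open>Q\<close> is the average of the
  densities in the cells inside \<open>Q\<close> up to the \<open>O(1 / M)\<close> fraction of \<open>Q\<close> near its boundary, so it is
  close to the same number, and likewise for \<open>Q'\<close>.
\<close>

section \<open>Measure and faces of cubes\<close>

text \<open>An isometry is Lipschitz with constant 1, and Lipschitz images of null sets within the
  same space are null. This disposes of cube boundaries and of the remainder in Vitali's
  theorem.\<close>

lemma negligible_orthogonal_image:
  fixes f :: "'a::euclidean_space \<Rightarrow> 'a"
  assumes f: "orthogonal_transformation f" and "negligible S"
  shows "negligible (f ` S)"
proof (rule negligible_locally_Lipschitz_image)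
  fix x
  have "norm (f y - f x) \<le> 1 * norm (y - x)" for y
    using orthogonal_transformation_norm[OF f, of "y - x"]
    by (simp add: linear_diff[OF orthogonal_transformation_linear[OF f]])
  then show "\<exists>T B. open T \<and> x \<in> T \<and> (\<forall>y \<in> S \<inter> T. norm (f y - f x) \<le> B * norm (y - x))"
    by blast
qed (simp_all add: assms)

text \<open>
  The library's change of variables for linear maps on \<open>real ^ 'n\<close> needs \<open>'n\<close> to be of class
  \<^class>\<open>wellorder\<close>. Here the claim is reduced to balls, which \<open>f\<close> maps to balls of the same radius,
  by filling \<open>S\<close> up to a null set with disjoint balls (Vitali).
\<close>

lemma emeasure_orthogonal_image_open:
  fixes f :: "'a::euclidean_space \<Rightarrow> 'a"
  assumes f: "orthogonal_transformation f" and "open S"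
  shows "emeasure lebesgue (f ` S) = emeasure lebesgue S"
proof -
  let ?K = "{(x, r). ball x r \<subseteq> S}"
  obtain C where C: "countable C" "C \<subseteq> ?K"
    and dis: "pairwise (\<lambda>i j. disjnt (ball (fst i) (snd i)) (ball (fst j) (snd j))) C"
    and neg: "negligible (S - (\<Union>i\<in>C. ball (fst i) (snd i)))"
  proof (rule Vitali_covering_theorem_balls[of S ?K fst snd])
    fix x d assume x: "x \<in> S" "(0::real) < d"
    then obtain e where e: "e > 0" "ball x e \<subseteq> S" using \<open>open S\<close> openE by blast
    \<comment> \<open>The bound \<open>e\<close> keeps the ball inside \<open>S\<close>; halving
      \<open>d\<close> makes the radius strictly smaller than \<open>d\<close>, as the covering
      theorem demands.\<close>
    have "ball x (min e (d/2)) \<subseteq> S" using e by auto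
    then show "\<exists>i. i \<in> ?K \<and> x \<in> ball (fst i) (snd i) \<and> snd i < d"
      using x e by (intro exI[of _ "(x, min e (d/2))"]) auto
  qed
  define B where "B i = ball (fst i) (snd i)" for i :: "'a \<times> real"
  have sub: "(\<Union>i\<in>C. B i) \<subseteq> S" using C(2) by (fastforce simp: B_def)
  have inj: "inj f" by (simp add: f orthogonal_transformation_inj)
  have fB: "f ` B i = ball (f (fst i)) (snd i)" for i
    by (simp add: B_def image_orthogonal_transformation_ball[OF f])
  have disjB: "disjoint_family_on B C"
    using dis by (auto simp: disjoint_family_on_def pairwise_def disjnt_def B_def)
  then have disjfB: "disjoint_family_on (\<lambda>i. f ` B i) C"
    using inj by (simp add: disjoint_family_on_def inj_def image_Int[symmetric])
  \<comment> \<open>The index set also contains pairs with negative radius, whose balls are empty;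
    hence the case distinction.\<close>
  have eqB: "emeasure lebesgue (f ` B i) = emeasure lebesgue (B i)" for i
    unfolding fB unfolding B_def
    by (cases "snd i \<ge> 0") (simp_all add: emeasure_ball ball_empty)
  have meq: "emeasure lebesgue (\<Union>i\<in>C. f ` B i) = emeasure lebesgue (\<Union>i\<in>C. B i)"
    using emeasure_UN_countable[OF _ C(1) disjfB, of lebesgue]
      emeasure_UN_countable[OF _ C(1) disjB, of lebesgue]
    by (simp only: eqB) (simp add: fB, simp add: B_def)
  have negf: "negligible (f ` (S - (\<Union>i\<in>C. B i)))"
    using f neg by (simp add: negligible_orthogonal_image B_def)
  have "f ` S = (\<Union>i\<in>C. f ` B i) \<union> f ` (S - (\<Union>i\<in>C. B i))"
    using sub by blast
  moreover have "(\<Union>i\<in>C. f ` B i) \<in> sets lebesgue"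
    using C(1) by (intro sets.countable_UN') (auto simp: fB)
  ultimately have "emeasure lebesgue (f ` S) = emeasure lebesgue (\<Union>i\<in>C. f ` B i)"
    using negf by (simp only: emeasure_Un_null_set negligible_iff_null_sets)
  also have "\<dots> = emeasure lebesgue (\<Union>i\<in>C. B i)" by (rule meq)
  also have "\<dots> = emeasure lebesgue ((\<Union>i\<in>C. B i) \<union> (S - (\<Union>i\<in>C. B i)))"
    using neg C(1) by (intro emeasure_Un_null_set[symmetric]) (auto simp: B_def negligible_iff_null_sets)
  also have "(\<Union>i\<in>C. B i) \<union> (S - (\<Union>i\<in>C. B i)) = S" using sub by blast
  finally show ?thesis .
qed

lemma measure_box_cube:
  fixes a :: "real^'n"
  assumes "l \<ge> 0"
  shows "measure lebesgue (box a (a + vec l)) = l ^ CARD('n)"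
proof -
  have "measure lebesgue (box a (a + vec l)) = measure lborel (cbox a (a + vec l))"
    using negligible_frontier_interval[of a "a + vec l"] box_subset_cbox[of a "a + vec l"]
    by (subst measure_negligible_symdiff[of "cbox a (a + vec l)"]) (auto intro: negligible_subset)
  also have "\<dots> = l ^ CARD('n)"
    using assms by (subst content_cbox_cart) (auto simp: interval_ne_empty_cart)
  finally show ?thesis .
qed

lemma measure_orthogonal_image_cube:
  fixes Q :: "(real^'n) set" and f :: "real^'n \<Rightarrow> real^'n"
  assumes f: "orthogonal_transformation f" and l: "l \<ge> 0"
    and Q: "f ` box a (a + vec l) \<subseteq> Q" "Q \<subseteq> f ` cbox a (a + vec l)"
  shows "Q \<in> lmeasurable" "measure lebesgue Q = l ^ CARD('n)"
proof -
  let ?B = "box a (a + vec l)"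
  have op: "open (f ` ?B)"
    by (rule open_surjective_linear_image[OF open_box orthogonal_transformation_linear[OF f]
          orthogonal_transformation_surj[OF f]])
  have bd: "bounded (f ` ?B)"
    using f by (intro bounded_linear_image) (auto simp: orthogonal_transformation_linear linear_linear)
  have m: "f ` ?B \<in> lmeasurable" using bd op by (rule lmeasurable_open)
  have meas: "measure lebesgue (f ` ?B) = l ^ CARD('n)"
    using emeasure_orthogonal_image_open[OF f open_box, of a "a + vec l"] measure_box_cube[OF l, of a]
    by (simp add: measure_def)
  have "negligible (f ` (cbox a (a + vec l) - ?B))"
    by (intro negligible_orthogonal_image f negligible_frontier_interval)
  then have neg: "negligible (f ` ?B - Q \<union> (Q - f ` ?B))"
    by (rule negligible_subset) (use Q in blast)
  show "Q \<in> lmeasurable" using lmeasurable_negligible_symdiff[OF m neg] .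
  show "measure lebesgue Q = l ^ CARD('n)"
    using measure_negligible_symdiff[OF m neg] meas by simp
qed

lemma axis_subset_all_cubes: "axis_cubes l \<subseteq> all_cubes l"
  unfolding all_cubes_def
  by (auto intro!: exI[of _ "\<lambda>x. x"])

section \<open>Closures, facets and consecutive cubes\<close>

lemma closure_axis_cube:
  fixes a :: "real^'n"
  assumes "l > 0" "box a (a + vec l) \<subseteq> Q" "Q \<subseteq> cbox a (a + vec l)"
  shows "closure Q = cbox a (a + vec l)"
proof
  have "box a (a + vec l) \<noteq> {}"
    using \<open>l > 0\<close> by (simp add: interval_ne_empty_cart)
  from closure_box[OF this] show "cbox a (a + vec l) \<subseteq> closure Q"
    using assms closure_mono by blast
  show "closure Q \<subseteq> cbox a (a + vec l)"
    using assms(3) by (rule closure_minimal) (rule closed_cbox)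
qed

text \<open>A supporting hyperplane cuts out a face. Its dimension is smaller by exactly one,
  because adjoining a single point of the opposite side already spans the box affinely.\<close>

lemma facet_of_cbox:
  fixes a b :: "real^'n"
  assumes ab: "\<And>j. a $ j < b $ j" and c: "c = a $ i \<or> c = b $ i"
  shows "(cbox a b \<inter> {x. x $ i = c}) facet_of cbox a b"
proof -
  let ?S = "cbox a b" and ?F = "cbox a b \<inter> {x. x $ i = c}"
  have face: "?F face_of ?S"
    using c
  proof
    assume "c = a $ i"
    then show ?thesis
      using face_of_Int_supporting_hyperplane_ge[of ?S c "axis i 1"]
      by (simp add: inner_axis' mem_box_cart)
  next
    assume "c = b $ i"
    then show ?thesis
      using face_of_Int_supporting_hyperplane_le[of ?S "axis i 1" c]
      by (simp add: inner_axis' mem_box_cart)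
  qed
  \<comment> \<open>The corners \<open>p\<close> and \<open>q\<close> lie on opposite sides and
    differ only in coordinate \<open>i\<close>, so \<open>p - q\<close> is the direction normal to
    the face.\<close>
  define c' where "c' = (if c = a $ i then b $ i else a $ i)"
  define p where "p = (\<chi> j. if j = i then c' else a $ j)"
  define q where "q = (\<chi> j. if j = i then c else a $ j)"
  have cc: "c' \<noteq> c" "a $ i \<le> c'" "c' \<le> b $ i" "a $ i \<le> c" "c \<le> b $ i"
    using ab[of i] c by (auto simp: c'_def)
  have p: "p \<in> ?S" "p \<notin> ?F" and q: "q \<in> ?F"
    using cc ab by (auto simp: mem_box_cart p_def q_def intro: less_imp_le)
  have lt: "aff_dim ?F < aff_dim ?S"
    using face p by (intro face_of_aff_dim_lt) auto
  have "?S \<subseteq> affine hull (insert p ?F)"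
  proof
    fix x assume x: "x \<in> ?S"
    \<comment> \<open>The projection of \<open>x\<close> to the face; a multiple of
      \<open>p - q\<close> leads from it back to \<open>x\<close>.\<close>
    define y where "y = (\<chi> j. if j = i then c else x $ j)"
    have "y \<in> ?F" using x cc by (auto simp: mem_box_cart y_def)
    then have "y + ((x $ i - c) / (c' - c)) *\<^sub>R (p - q) \<in> affine hull (insert p ?F)"
      using q by (intro mem_affine_3_minus) (auto intro: hull_inc)
    also have "y + ((x $ i - c) / (c' - c)) *\<^sub>R (p - q) = x"
      using cc by (auto simp: vec_eq_iff y_def p_def q_def)
    finally show "x \<in> affine hull (insert p ?F)" .
  qed
  then have "aff_dim ?S \<le> aff_dim (insert p ?F)"
    by (metis aff_dim_affine_hull aff_dim_subset)
  also have "\<dots> \<le> aff_dim ?F + 1"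
    by (simp add: aff_dim_insert)
  finally show ?thesis
    using face q lt by (auto simp: facet_of_def)
qed

text \<open>The closures meet in the slice where coordinate \<open>i\<close> equals
  \<open>a $ i + l\<close>, the upper side of one cube and the lower side of the other. This
  provides the consecutive pairs needed later: neighbouring grid cells, and a witness that the
  supremum in the definition of smoothness is over a nonempty set.\<close>

lemma consecutive_translate:
  fixes a :: "real^'n"
  assumes l: "l > 0"
    and Q: "box a (a + vec l) \<subseteq> Q" "Q \<subseteq> cbox a (a + vec l)"
    and a': "a' = a + axis i l"
    and Q': "box a' (a' + vec l) \<subseteq> Q'" "Q' \<subseteq> cbox a' (a' + vec l)"
  shows "consecutive Q Q'"
proof -
  have a'_nth: "a' $ j = (if j = i then a $ i + l else a $ j)" for j
    by (simp add: a' axis_def)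
  have mem: "x \<in> cbox a (a + vec l) \<inter> cbox a' (a' + vec l) \<longleftrightarrow> x \<in> cbox a (a + vec l) \<and> x $ i = a $ i + l"
    "x \<in> cbox a (a + vec l) \<inter> cbox a' (a' + vec l) \<longleftrightarrow> x \<in> cbox a' (a' + vec l) \<and> x $ i = a $ i + l" for x
    using l unfolding mem_box_cart Int_iff vector_add_component vec_component a'_nth
    by (smt (verit))+
  have 1: "cbox a (a + vec l) \<inter> cbox a' (a' + vec l) = cbox a (a + vec l) \<inter> {x. x $ i = a $ i + l}"
    using mem(1) by blast
  have 2: "cbox a (a + vec l) \<inter> cbox a' (a' + vec l) = cbox a' (a' + vec l) \<inter> {x. x $ i = a $ i + l}"
    using mem(2) by blast
  show ?thesis
    unfolding consecutive_def closure_axis_cube[OF l Q] closure_axis_cube[OF l Q']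
  proof
    show "(cbox a (a + vec l) \<inter> cbox a' (a' + vec l)) facet_of cbox a (a + vec l)"
      unfolding 1 using l by (intro facet_of_cbox) auto
    show "(cbox a (a + vec l) \<inter> cbox a' (a' + vec l)) facet_of cbox a' (a' + vec l)"
      unfolding 2 using l by (intro facet_of_cbox) (auto simp: a')
  qed
qed

section \<open>Smoothness without suprema\<close>

lemma density_in_nonneg: "0 \<le> density_in A Q"
  by (simp add: density_in_def)

lemma density_in_le_1:
  assumes "A \<in> sets lebesgue" "Q \<in> lmeasurable"
  shows "density_in A Q \<le> 1"
proof -
  have "measure lebesgue (A \<inter> Q) \<le> measure lebesgue Q"
    using assms by (intro measure_mono_fmeasurable) (auto simp: fmeasurableD)
  then show ?thesis
    by (simp add: density_in_def divide_le_eq_1)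
      (metis less_eq_real_def measure_nonneg)
qed

lemma all_cubesE:
  fixes Q :: "(real^'n) set"
  assumes "Q \<in> all_cubes l"
  obtains f a where "orthogonal_transformation (f :: real^'n \<Rightarrow> real^'n)" "l > 0"
    "f ` box a (a + vec l) \<subseteq> Q" "Q \<subseteq> f ` cbox a (a + vec l)"
  using assms unfolding all_cubes_def axis_cubes_def by blast

lemma all_cubes_lmeasurable: "Q \<in> all_cubes l \<Longrightarrow> Q \<in> lmeasurable"
  and all_cubes_measure: "(Q :: (real^'n) set) \<in> all_cubes l \<Longrightarrow> measure lebesgue Q = l ^ CARD('n)"
  by (meson all_cubesE less_imp_le measure_orthogonal_image_cube)+

text \<open>Brings smoothness into the form of the other two conditions, so that only the families
  of cubes remain to be compared. The supremum can be replaced by a bound for each pair since, for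
  \<open>\<delta> > 0\<close>, it is over a nonempty set of numbers in \<open>[0, 1]\<close>. Values
  \<open>l \<le> 0\<close> do no harm: there are no cubes of such sidelength.\<close>

lemma smooth_set_iff:
  fixes A :: "(real ^ 'n) set"
  assumes A: "A \<in> sets lebesgue"
  shows "smooth_set A \<longleftrightarrow> (\<forall>\<epsilon>>0. \<exists>\<delta>>0. \<forall>l<\<delta>. \<forall>Q\<in>axis_cubes l. \<forall>Q'\<in>axis_cubes l.
             consecutive Q Q' \<longrightarrow> \<bar>density_in A Q - density_in A Q'\<bar> \<le> \<epsilon>)"
    (is "_ \<longleftrightarrow> (\<forall>\<epsilon>>0. \<exists>\<delta>>0. \<forall>l<\<delta>. ?P \<epsilon> l)")
proof -
  define X :: "real \<Rightarrow> ((real ^ 'n) set \<times> (real ^ 'n) set) set" where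
    "X \<delta> = {(Q, Q'). \<exists>l\<le>\<delta>. Q \<in> axis_cubes l \<and> Q' \<in> axis_cubes l \<and> consecutive Q Q'}" for \<delta>
  define D where "D = (\<lambda>(Q, Q'). \<bar>density_in A Q - density_in A Q'\<bar>)"
  have D_le: "0 \<le> D p" "D p \<le> 1" if "p \<in> X \<delta>" for p \<delta>
  proof -
    obtain Q Q' l where p: "p = (Q, Q')" "Q \<in> axis_cubes l" "Q' \<in> axis_cubes l"
      using \<open>p \<in> X \<delta>\<close> by (auto simp: X_def)
    then have "Q \<in> lmeasurable" "Q' \<in> lmeasurable"
      using axis_subset_all_cubes all_cubes_lmeasurable by blast+
    then show "0 \<le> D p" "D p \<le> 1"
      using density_in_le_1[OF A, of Q] density_in_le_1[OF A, of Q']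
        density_in_nonneg[of A Q] density_in_nonneg[of A Q'] by (auto simp: D_def p)
  qed
  then have bdd: "bdd_above (D ` X \<delta>)" for \<delta>
    by (meson bdd_aboveI2)
  have ne: "X \<delta> \<noteq> {}" if "\<delta> > 0" for \<delta>
  proof -
    let ?Q = "cbox 0 (0 + vec \<delta>) :: (real^'n) set"
    \<comment> \<open>Here \<open>undefined\<close> is just some coordinate direction.\<close>
    let ?Q' = "cbox (0 + axis undefined \<delta>) (0 + axis undefined \<delta> + vec \<delta>) :: (real^'n) set"
    have "consecutive ?Q ?Q'"
      by (rule consecutive_translate[OF that box_subset_cbox order_refl refl box_subset_cbox order_refl])
    moreover have "?Q \<in> axis_cubes \<delta>" "?Q' \<in> axis_cubes \<delta>"
      unfolding axis_cubes_def using that box_subset_cbox by blast+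
    ultimately have "(?Q, ?Q') \<in> X \<delta>" by (auto simp: X_def)
    then show ?thesis by blast
  qed
  have Sup: "0 \<le> Sup (D ` X \<delta>)" if "\<delta> > 0" for \<delta>
    using ne[OF that] D_le(1) bdd by (meson all_not_in_conv cSUP_upper2)
  have le_iff: "Sup (D ` X \<delta>) \<le> \<epsilon> \<longleftrightarrow> (\<forall>p\<in>X \<delta>. D p \<le> \<epsilon>)" if "\<delta> > 0" for \<delta> \<epsilon>
    using cSUP_le_iff[OF ne[OF that] bdd] .
  have "smooth_set A \<longleftrightarrow> ((\<lambda>\<delta>. Sup (D ` X \<delta>)) \<longlongrightarrow> 0) (at_right 0)"
    using A by (simp add: smooth_set_def X_def D_def)
  also have "\<dots> \<longleftrightarrow> (\<forall>\<epsilon>>0. \<exists>\<delta>>0. \<forall>l<\<delta>. ?P \<epsilon> l)"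
  proof (intro iffI allI impI)
    fix \<epsilon> :: real
    assume "((\<lambda>\<delta>. Sup (D ` X \<delta>)) \<longlongrightarrow> 0) (at_right 0)" "\<epsilon> > 0"
    then have "eventually (\<lambda>\<delta>. Sup (D ` X \<delta>) < \<epsilon>) (at_right 0)"
      by (rule order_tendstoD)
    then obtain b where b: "b > 0" "\<And>\<delta>. 0 < \<delta> \<Longrightarrow> \<delta> < b \<Longrightarrow> Sup (D ` X \<delta>) < \<epsilon>"
      by (auto simp: eventually_at_right_field)
    have "?P \<epsilon> l" if "l < b" for l
    proof (intro ballI impI)
      fix Q Q' :: "(real ^ 'n) set"
      assume Q: "Q \<in> axis_cubes l" "Q' \<in> axis_cubes l" "consecutive Q Q'"
      then have "l > 0" by (simp add: axis_cubes_def)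
      moreover have "(Q, Q') \<in> X l" using Q by (auto simp: X_def)
      ultimately show "\<bar>density_in A Q - density_in A Q'\<bar> \<le> \<epsilon>"
        using b(2)[of l] \<open>l < b\<close> le_iff[of l \<epsilon>] by (auto simp: D_def)
    qed
    with \<open>b > 0\<close> show "\<exists>\<delta>>0. \<forall>l<\<delta>. ?P \<epsilon> l" by blast
  next
    assume *: "\<forall>\<epsilon>>0. \<exists>\<delta>>0. \<forall>l<\<delta>. ?P \<epsilon> l"
    show "((\<lambda>\<delta>. Sup (D ` X \<delta>)) \<longlongrightarrow> 0) (at_right 0)"
    proof (rule tendstoI)
      fix e :: real assume "e > 0"
      \<comment> \<open>A bound on all pairs gives only a non-strict bound on their supremum;
        \<open>e / 2\<close> restores the strict inequality.\<close>
      then obtain b where b: "b > 0" "\<And>l. l < b \<Longrightarrow> ?P (e / 2) l"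
        using *[rule_format, of "e / 2"] by auto
      have "dist (Sup (D ` X \<delta>)) 0 < e" if "0 < \<delta>" "\<delta> < b" for \<delta>
      proof -
        have "D p \<le> e / 2" if "p \<in> X \<delta>" for p
        proof -
          obtain Q Q' l where "p = (Q, Q')" "l \<le> \<delta>" "Q \<in> axis_cubes l" "Q' \<in> axis_cubes l" "consecutive Q Q'"
            using \<open>p \<in> X \<delta>\<close> by (auto simp: X_def)
          then show ?thesis using b(2)[of l] \<open>\<delta> < b\<close> by (auto simp: D_def)
        qed
        then have "Sup (D ` X \<delta>) \<le> e / 2"
          using le_iff[OF that(1)] by blast
        with Sup[OF that(1)] \<open>e > 0\<close> show ?thesis by (simp add: dist_real_def)
      qed
      with \<open>b > 0\<close> show "eventually (\<lambda>\<delta>. dist (Sup (D ` X \<delta>)) 0 < e) (at_right 0)"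
        by (auto simp: eventually_at_right_field)
    qed
  qed
  finally show ?thesis .
qed

section \<open>Comparison with the cells of a grid\<close>

text \<open>The mesh \<open>h\<close> is an arbitrary real, with dyadic cubes as the case of a power
  of two. The cells are half-open so that they partition space when \<open>h > 0\<close>.\<close>

definition grid_cell :: "real \<Rightarrow> ('n::finite \<Rightarrow> int) \<Rightarrow> (real^'n) set" where
  "grid_cell h m = {x. \<forall>i. of_int (m i) * h \<le> x $ i \<and> x $ i < (of_int (m i) + 1) * h}"

lemma grid_cell_bounds:
  fixes m :: "'n::finite \<Rightarrow> int" and h :: real
  defines "a \<equiv> \<chi> i. of_int (m i) * h"
  shows "box a (a + vec h) \<subseteq> grid_cell h m" "grid_cell h m \<subseteq> cbox a (a + vec h)"
  by (auto simp: a_def grid_cell_def mem_box_cart algebra_simps)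
    (meson less_imp_le)+

lemma grid_cell_axis_cubes: "h > 0 \<Longrightarrow> grid_cell h m \<in> axis_cubes h"
  unfolding axis_cubes_def using grid_cell_bounds by blast

lemma dyadic_cubes_eq: "dyadic_cubes l = {grid_cell l m | k m. l = 2 powi (- k)}"
  by (auto simp: dyadic_cubes_def grid_cell_def)

lemma dyadic_subset_axis_cubes: "dyadic_cubes l \<subseteq> axis_cubes l"
  by (auto simp: dyadic_cubes_eq intro: grid_cell_axis_cubes)

lemma consecutive_grid_cell:
  assumes "h > 0"
  shows "consecutive (grid_cell h m) (grid_cell h (m(i := m i + 1)))"
  by (rule consecutive_translate[OF assms grid_cell_bounds _ grid_cell_bounds])
    (auto simp: vec_eq_iff axis_def algebra_simps)

text \<open>The partition property in usable form: it yields both the cell containing a given point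
  and the disjointness of different cells.\<close>

lemma mem_grid_cell_iff:
  assumes "h > 0"
  shows "x \<in> grid_cell h m \<longleftrightarrow> m = (\<lambda>i. \<lfloor>x $ i / h\<rfloor>)"
proof -
  have "\<lfloor>x $ i / h\<rfloor> = m i \<longleftrightarrow> of_int (m i) * h \<le> x $ i \<and> x $ i < (of_int (m i) + 1) * h" for i
    using assms by (simp add: floor_eq_iff field_simps)
  then show ?thesis by (auto simp: grid_cell_def fun_eq_iff)
qed

section \<open>Chains of neighbouring cells and averages of densities\<close>

text \<open>Walk from \<open>m\<close> to \<open>m'\<close> changing one coordinate by one at a
  time; the number of moves is the l1 distance, on which the induction runs.\<close>

lemma lattice_path_bound:
  fixes d :: "('n::finite \<Rightarrow> int) \<Rightarrow> real"
  assumes step: "\<And>m i. \<bar>d m - d (m(i := m i + 1))\<bar> \<le> \<epsilon>"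
  shows "\<bar>d m - d m'\<bar> \<le> \<epsilon> * of_int (\<Sum>i\<in>UNIV. \<bar>m i - m' i\<bar>)"
proof (induction "nat (\<Sum>i\<in>UNIV. \<bar>m i - m' i\<bar>)" arbitrary: m)
  case 0
  then have "(\<Sum>i\<in>UNIV. \<bar>m i - m' i\<bar>) = 0"
    by (simp add: sum_nonneg order_antisym)
  then have "m = m'" by (auto simp: sum_nonneg_eq_0_iff)
  then show ?case by simp
next
  case (Suc N)
  have "\<exists>i. m i \<noteq> m' i"
  proof (rule ccontr)
    assume "\<not> ?thesis"
    then show False using Suc.hyps(2) by simp
  qed
  then obtain i where i: "m i \<noteq> m' i" by blast
  \<comment> \<open>The sign is chosen so that the move brings coordinate \<open>i\<close> closer to
    \<open>m' i\<close>.\<close>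
  define s :: int where "s = (if m i < m' i then 1 else - 1)"
  define m1 where "m1 = m(i := m i + s)"
  have "(\<Sum>j\<in>UNIV. \<bar>m1 j - m' j\<bar>) = \<bar>m1 i - m' i\<bar> + (\<Sum>j\<in>UNIV - {i}. \<bar>m1 j - m' j\<bar>)"
    by (simp add: sum.remove)
  also have "\<dots> = \<bar>m i - m' i\<bar> - 1 + (\<Sum>j\<in>UNIV - {i}. \<bar>m j - m' j\<bar>)"
    using i by (intro arg_cong2[of _ _ _ _ "(+)"] sum.cong) (auto simp: m1_def s_def)
  also have "\<dots> = (\<Sum>j\<in>UNIV. \<bar>m j - m' j\<bar>) - 1"
    by (simp add: sum.remove[of UNIV i])
  finally have sum: "(\<Sum>j\<in>UNIV. \<bar>m1 j - m' j\<bar>) = (\<Sum>j\<in>UNIV. \<bar>m j - m' j\<bar>) - 1" .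
  have "\<bar>d m1 - d m'\<bar> \<le> \<epsilon> * of_int (\<Sum>j\<in>UNIV. \<bar>m1 j - m' j\<bar>)"
    using Suc.hyps(2) by (intro Suc.hyps(1)) (simp add: sum)
  moreover have "\<bar>d m - d m1\<bar> \<le> \<epsilon>"
  proof (cases "m i < m' i")
    case True
    then show ?thesis using step[of m i] by (simp add: m1_def s_def)
  next
    case False
    \<comment> \<open>The hypothesis speaks of upward moves, so a downward move is read
      backwards.\<close>
    then have "m = m1(i := m1 i + 1)" by (simp add: m1_def s_def)
    then show ?thesis using step[of m1 i] by (metis abs_minus_commute)
  qed
  ultimately have "\<bar>d m - d m'\<bar> \<le> \<epsilon> + \<epsilon> * of_int (\<Sum>j\<in>UNIV. \<bar>m1 j - m' j\<bar>)"
    by linarith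
  then show ?case by (simp add: sum algebra_simps)
qed

text \<open>The density in the union of the pieces is a weighted average of densities within
  \<open>\<eta>\<close> of \<open>c\<close>, and the uncovered part of \<open>Q\<close> adds at most
  its share \<open>\<sigma>\<close>.\<close>

lemma density_average:
  assumes A: "A \<in> sets lebesgue" and Q: "Q \<in> lmeasurable" "measure lebesgue Q > 0"
    and K: "finite K" and P: "\<And>k. k \<in> K \<Longrightarrow> P k \<in> lmeasurable"
      "\<And>k. k \<in> K \<Longrightarrow> measure lebesgue (P k) > 0" "\<And>k. k \<in> K \<Longrightarrow> P k \<subseteq> Q"
    and disj: "pairwise (\<lambda>i j. disjnt (P i) (P j)) K"
    and close: "\<And>k. k \<in> K \<Longrightarrow> \<bar>density_in A (P k) - c\<bar> \<le> \<eta>" and "\<eta> \<ge> 0"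
    and c: "0 \<le> c" "c \<le> 1"
    and rest: "measure lebesgue Q - measure lebesgue (\<Union>k\<in>K. P k) \<le> \<sigma> * measure lebesgue Q"
  shows "\<bar>density_in A Q - c\<bar> \<le> \<eta> + \<sigma>"
proof -
  let ?\<mu> = "measure lebesgue"
  define U where "U = (\<Union>k\<in>K. P k)"
  have U: "U \<in> lmeasurable" "U \<subseteq> Q" using K P by (auto simp: U_def)
  have AP: "A \<inter> P k \<in> lmeasurable" if "k \<in> K" for k
    using A P(1)[OF that] by (metis Int_commute fmeasurable_Int_fmeasurable)
  have AU: "A \<inter> U \<in> lmeasurable" "A \<inter> Q \<in> lmeasurable"
    using A U(1) Q(1) by (metis Int_commute fmeasurable_Int_fmeasurable)+
  have sumU: "?\<mu> U = (\<Sum>k\<in>K. ?\<mu> (P k))"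
    unfolding U_def using K P(1) disj by (rule measure_UNION')
  have "A \<inter> U = (\<Union>k\<in>K. A \<inter> P k)" by (auto simp: U_def)
  also have "?\<mu> \<dots> = (\<Sum>k\<in>K. ?\<mu> (A \<inter> P k))"
    using K AP disj by (intro measure_UNION') (auto simp: pairwise_def disjnt_def)
  finally have sumAU: "?\<mu> (A \<inter> U) = (\<Sum>k\<in>K. ?\<mu> (A \<inter> P k))" .
  have "\<bar>?\<mu> (A \<inter> P k) - c * ?\<mu> (P k)\<bar> \<le> \<eta> * ?\<mu> (P k)" if k: "k \<in> K" for k
  proof -
    have "?\<mu> (A \<inter> P k) - c * ?\<mu> (P k) = (density_in A (P k) - c) * ?\<mu> (P k)"
      using P(2)[OF k] by (simp add: density_in_def field_simps)
    then show ?thesis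
      using close[OF k] by (simp add: abs_mult mult_right_mono)
  qed
  then have "\<bar>\<Sum>k\<in>K. ?\<mu> (A \<inter> P k) - c * ?\<mu> (P k)\<bar> \<le> (\<Sum>k\<in>K. \<eta> * ?\<mu> (P k))"
    by (intro order_trans[OF sum_abs] sum_mono)
  then have 1: "\<bar>?\<mu> (A \<inter> U) - c * ?\<mu> U\<bar> \<le> \<eta> * ?\<mu> U"
    by (simp add: sumAU sumU sum_subtractf sum_distrib_left)
  have "?\<mu> U \<le> ?\<mu> Q" using U Q by (intro measure_mono_fmeasurable) auto
  then have 2: "\<eta> * ?\<mu> U \<le> \<eta> * ?\<mu> Q" using \<open>\<eta> \<ge> 0\<close> by (rule mult_left_mono)
  have QU: "?\<mu> (Q - U) = ?\<mu> Q - ?\<mu> U"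
    using U Q by (intro measurable_measure_Diff) auto
  have "?\<mu> (A \<inter> Q - A \<inter> U) = ?\<mu> (A \<inter> Q) - ?\<mu> (A \<inter> U)"
    using U AU by (intro measurable_measure_Diff) auto
  moreover have "?\<mu> (A \<inter> Q - A \<inter> U) \<le> ?\<mu> (Q - U)"
    using U Q AU by (intro measure_mono_fmeasurable) (auto intro: fmeasurable.Diff)
  moreover have "0 \<le> ?\<mu> (A \<inter> Q - A \<inter> U)" by simp
  \<comment> \<open>On \<open>Q - U\<close> the measure of \<open>A\<close> and \<open>c\<close>
    times the full measure both lie between 0 and the measure of \<open>Q - U\<close>. Their
    difference therefore costs \<open>\<sigma>\<close> only once.\<close>
  moreover have "0 \<le> c * ?\<mu> Q - c * ?\<mu> U" "c * ?\<mu> Q - c * ?\<mu> U \<le> ?\<mu> Q - ?\<mu> U"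
    using c \<open>?\<mu> U \<le> ?\<mu> Q\<close> mult_left_le_one_le[of "?\<mu> Q - ?\<mu> U" c]
    by (auto simp: right_diff_distrib intro: mult_left_mono)
  ultimately have "\<bar>?\<mu> (A \<inter> Q) - c * ?\<mu> Q\<bar> \<le> \<eta> * ?\<mu> Q + \<sigma> * ?\<mu> Q"
    using 1 2 QU rest unfolding U_def[symmetric] abs_le_iff by linarith
  moreover have "?\<mu> (A \<inter> Q) - c * ?\<mu> Q = (density_in A Q - c) * ?\<mu> Q"
    using Q(2) by (simp add: density_in_def left_diff_distrib)
  ultimately have "\<bar>(density_in A Q - c) * ?\<mu> Q\<bar> \<le> (\<eta> + \<sigma>) * ?\<mu> Q"
    by (simp add: distrib_right)
  then show ?thesis using Q(2) by (simp add: abs_mult)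
qed

section \<open>Diameters, index distances and the cells inside a cube\<close>

lemma norm_le_card_cart:
  fixes x :: "real^'n" and b :: real
  assumes "\<And>i. \<bar>x $ i\<bar> \<le> b"
  shows "norm x \<le> CARD('n) * b"
proof -
  have "norm x \<le> (\<Sum>i\<in>UNIV. \<bar>x $ i\<bar>)" by (rule norm_le_l1_cart)
  also have "\<dots> \<le> (\<Sum>i\<in>(UNIV::'n set). b)" by (rule sum_mono) (rule assms)
  also have "\<dots> = CARD('n) * b" by (rule sum_constant)
  finally show ?thesis .
qed

text \<open>Pulling back by the isometry reduces this to an axis-parallel cube. Closures are needed
  because the common point of two consecutive cubes may belong to neither.\<close>

lemma dist_closure_all_cubes:
  fixes Q :: "(real^'n) set" and l :: real
  assumes Q: "Q \<in> all_cubes l" and xz: "x \<in> closure Q" "z \<in> closure Q"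
  shows "norm (x - z) \<le> CARD('n) * l"
proof -
  obtain f a where f: "orthogonal_transformation (f :: real^'n \<Rightarrow> real^'n)" "l > 0"
    and Qf: "f ` box a (a + vec l) \<subseteq> Q" "Q \<subseteq> f ` cbox a (a + vec l)"
    using all_cubesE[OF Q] .
  have lin: "linear f" using f(1) by (rule orthogonal_transformation_linear)
  have "closed (f ` cbox a (a + vec l))"
    by (intro compact_imp_closed compact_continuous_image linear_continuous_on compact_cbox)
      (use lin in \<open>simp add: linear_linear\<close>)
  with Qf(2) have "closure Q \<subseteq> f ` cbox a (a + vec l)" by (rule closure_minimal)
  with xz obtain u v where uv: "x = f u" "z = f v" "u \<in> cbox a (a + vec l)" "v \<in> cbox a (a + vec l)"
    by blast
  have "norm (x - z) = norm (u - v)"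
    using orthogonal_transformation_norm[OF f(1), of "u - v"] by (simp add: uv linear_diff[OF lin])
  also have "\<dots> \<le> CARD('n) * l"
  proof (rule norm_le_card_cart)
    fix i
    show "\<bar>(u - v) $ i\<bar> \<le> l"
      using uv(3,4)[unfolded mem_box_cart, THEN spec[of _ i]] by (auto simp: abs_le_iff)
  qed
  finally show ?thesis .
qed

lemma grid_cell_diameter:
  fixes x y :: "real^'n" and h :: real
  assumes "x \<in> grid_cell h m" "y \<in> grid_cell h m"
  shows "norm (x - y) \<le> CARD('n) * h"
proof (rule norm_le_card_cart)
  fix i
  show "\<bar>(x - y) $ i\<bar> \<le> h"
    using assms[unfolded grid_cell_def mem_Collect_eq, THEN spec[of _ i]]
    by (auto simp: algebra_simps)
qed

text \<open>Indices are floors of the scaled coordinates, and rounding adds at most 1 to the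
  difference.\<close>

lemma grid_index_dist:
  fixes x z :: "real^'n"
  assumes "h > 0" "x \<in> grid_cell h m" "z \<in> grid_cell h m'"
  shows "\<bar>real_of_int (m i - m' i)\<bar> \<le> norm (x - z) / h + 1"
proof -
  have m: "m i = \<lfloor>x $ i / h\<rfloor>" "m' i = \<lfloor>z $ i / h\<rfloor>"
    using assms by (auto simp: mem_grid_cell_iff)
  have "\<bar>x $ i / h - z $ i / h\<bar> = \<bar>(x - z) $ i\<bar> / h"
    using \<open>h > 0\<close> by (simp add: abs_divide flip: diff_divide_distrib)
  also have "\<dots> \<le> norm (x - z) / h"
    using \<open>h > 0\<close> by (intro divide_right_mono component_le_norm_cart) auto
  finally show ?thesis unfolding m by linarith
qed

text \<open>
  A cell has diameter at most \<open>CARD('n) * h\<close>, so the cells inside \<open>Q\<close> cover the concentric cube of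
  sidelength \<open>l - 2 * CARD('n) * h\<close>; Bernoulli's inequality compares the two volumes.
\<close>

lemma interior_grid_cells_measure:
  fixes Q :: "(real^'n) set" and h l :: real
  assumes Q: "Q \<in> all_cubes l" and h: "h > 0" "2 * CARD('n) * h \<le> l"
    and U: "U = \<Union>{grid_cell h m | m. grid_cell h m \<subseteq> Q}" "U \<in> lmeasurable"
  shows "measure lebesgue Q - measure lebesgue U \<le> (2 * CARD('n)^2 * h / l) * measure lebesgue Q"
proof -
  obtain f a where f: "orthogonal_transformation (f :: real^'n \<Rightarrow> real^'n)" and l: "l > 0"
    and Qf: "f ` box a (a + vec l) \<subseteq> Q" "Q \<subseteq> f ` cbox a (a + vec l)"
    using all_cubesE[OF Q] .
  define r where "r = CARD('n) * h"
  define I where "I = f ` box (a + vec r) (a + vec r + vec (l - 2 * r))"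
  have r: "r > 0" "2 * r \<le> l" using h by (auto simp: r_def)
  have I: "I \<in> lmeasurable" "measure lebesgue I = (l - 2 * r) ^ CARD('n)"
    using measure_orthogonal_image_cube[OF f, of "l - 2 * r" "a + vec r" I] r
    by (auto simp: I_def image_mono box_subset_cbox)
  have "I \<subseteq> U"
  proof
    fix x assume "x \<in> I"
    then obtain y where y: "x = f y" "y \<in> box (a + vec r) (a + vec r + vec (l - 2 * r))"
      by (auto simp: I_def)
    define m where "m = (\<lambda>i. \<lfloor>x $ i / h\<rfloor>)"
    have x: "x \<in> grid_cell h m" using h by (simp add: mem_grid_cell_iff m_def)
    have "grid_cell h m \<subseteq> Q"
    proof
      fix z assume z: "z \<in> grid_cell h m"
      \<comment> \<open>In the coordinates before applying \<open>f\<close> the cube is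
        axis-parallel, and the norm bound can be used in each coordinate.\<close>
      obtain w where w: "z = f w" using orthogonal_transformation_surj[OF f] by blast
      have "norm (w - y) = norm (z - x)"
        using orthogonal_transformation_norm[OF f, of "w - y"]
        by (simp add: w y linear_diff[OF orthogonal_transformation_linear[OF f]])
      then have "norm (w - y) \<le> r"
        using grid_cell_diameter[OF z x] by (simp add: r_def)
      then have "\<bar>w $ i - y $ i\<bar> \<le> r" for i
        using component_le_norm_cart[of "w - y" i] by simp
      then have wy: "w $ i \<le> y $ i + r" "y $ i \<le> w $ i + r" for i
        by (simp_all add: abs_le_iff algebra_simps)
      have "w \<in> box a (a + vec l)"
        unfolding mem_box_cart
      proof
        fix i
        show "a $ i < w $ i \<and> w $ i < (a + vec l) $ i"
          using y(2)[unfolded mem_box_cart, THEN spec[of _ i]] wy[of i] by simp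
      qed
      then show "z \<in> Q" using Qf w by blast
    qed
    then show "x \<in> U" using x U by blast
  qed
  then have IU: "(l - 2 * r) ^ CARD('n) \<le> measure lebesgue U"
    using measure_mono_fmeasurable[of I U lebesgue] I U by (simp add: fmeasurableD)
  \<comment> \<open>Bernoulli's inequality requires \<open>2 * r / l \<le> 1\<close>, which is the
    assumed bound on \<open>h\<close>.\<close>
  have "1 + CARD('n) * (- (2 * r / l)) \<le> (1 + - (2 * r / l)) ^ CARD('n)"
    using r l by (intro Bernoulli_inequality) (simp add: field_simps)
  then have "l ^ CARD('n) * (1 - CARD('n) * (2 * r / l)) \<le> l ^ CARD('n) * (1 - 2 * r / l) ^ CARD('n)"
    using l by (intro mult_left_mono) auto
  also have "\<dots> = (l - 2 * r) ^ CARD('n)"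
    using l by (simp add: algebra_simps flip: power_mult_distrib)
  finally show ?thesis
    using IU unfolding all_cubes_measure[OF Q]
    by (simp add: r_def power2_eq_square algebra_simps)
qed

text \<open>The first error term is \<open>\<epsilon>\<close> times a bound on the length of a chain
  from the cell of \<open>z\<close> to a cell inside \<open>Q\<close>; the second is the fraction of
  \<open>Q\<close> near its boundary. The reference cell depends only on \<open>z\<close>, so cubes
  whose closures share \<open>z\<close> are compared with the same number.\<close>

lemma density_near_grid_cell:
  fixes A Q :: "(real^'n) set" and h l :: real
  assumes A: "A \<in> sets lebesgue" and h: "h > 0" "2 * CARD('n) * h \<le> l" and "\<epsilon> \<ge> 0"
    and step: "\<And>m i. \<bar>density_in A (grid_cell h m) - density_in A (grid_cell h (m(i := m i + 1)))\<bar> \<le> \<epsilon>"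
    and Q: "Q \<in> all_cubes l" and z: "z \<in> closure Q" "z \<in> grid_cell h m"
  shows "\<bar>density_in A Q - density_in A (grid_cell h m)\<bar> \<le>
    \<epsilon> * (CARD('n) * (CARD('n) * l / h + 1)) + 2 * CARD('n)^2 * h / l"
proof -
  have l: "l > 0" using all_cubesE[OF Q] by blast
  define K where "K = {m'. grid_cell h m' \<subseteq> Q}"
  have cell: "grid_cell h m' \<in> lmeasurable" "measure lebesgue (grid_cell h m') > 0" for m' :: "'n \<Rightarrow> int"
  proof -
    have "grid_cell h m' \<in> all_cubes h"
      using grid_cell_axis_cubes[OF h(1)] axis_subset_all_cubes by blast
    then show "grid_cell h m' \<in> lmeasurable" "measure lebesgue (grid_cell h m') > 0"
      using h(1) by (simp_all add: all_cubes_lmeasurable all_cubes_measure)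
  qed
  have dist: "\<bar>real_of_int (m' i - m i)\<bar> \<le> CARD('n) * l / h + 1" if "m' \<in> K" for m' i
  proof -
    \<comment> \<open>The lowest corner, which belongs to the half-open cell, represents it.\<close>
    have "(\<chi> j. of_int (m' j) * h) \<in> grid_cell h m'" (is "?x \<in> _")
      using h by (simp add: grid_cell_def)
    moreover from this have "?x \<in> closure Q" using \<open>m' \<in> K\<close> closure_subset K_def by blast
    ultimately have "\<bar>real_of_int (m' i - m i)\<bar> \<le> norm (?x - z) / h + 1" "norm (?x - z) \<le> CARD('n) * l"
      using grid_index_dist[OF h(1) _ z(2)] dist_closure_all_cubes[OF Q _ z(1)] by blast+
    then show ?thesis
      using divide_right_mono[of "norm (?x - z)" "CARD('n) * l" h] h by linarith
  qed
  \<comment> \<open>The indices lie in a bounded box, so only finitely many cells fit into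
    \<open>Q\<close>.\<close>
  have "K \<subseteq> PiE UNIV (\<lambda>i. {m i - \<lceil>CARD('n) * l / h + 1\<rceil> .. m i + \<lceil>CARD('n) * l / h + 1\<rceil>})"
  proof
    fix m' assume "m' \<in> K"
    have "m' i \<in> {m i - \<lceil>CARD('n) * l / h + 1\<rceil> .. m i + \<lceil>CARD('n) * l / h + 1\<rceil>}" for i
      using dist[OF \<open>m' \<in> K\<close>, of i] unfolding atLeastAtMost_iff by linarith
    then show "m' \<in> PiE UNIV (\<lambda>i. {m i - \<lceil>CARD('n) * l / h + 1\<rceil> .. m i + \<lceil>CARD('n) * l / h + 1\<rceil>})"
      by auto
  qed
  then have K: "finite K" by (rule finite_subset) (auto intro: finite_PiE)
  have close: "\<bar>density_in A (grid_cell h m') - density_in A (grid_cell h m)\<bar>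
      \<le> \<epsilon> * (CARD('n) * (CARD('n) * l / h + 1))" if "m' \<in> K" for m'
  proof -
    have "\<bar>density_in A (grid_cell h m') - density_in A (grid_cell h m)\<bar>
        \<le> \<epsilon> * of_int (\<Sum>i\<in>UNIV. \<bar>m' i - m i\<bar>)"
      by (rule lattice_path_bound[of "\<lambda>m. density_in A (grid_cell h m)"]) (rule step)
    also have "real_of_int (\<Sum>i\<in>UNIV. \<bar>m' i - m i\<bar>) \<le> CARD('n) * (CARD('n) * l / h + 1)"
      using sum_bounded_above[of UNIV "\<lambda>i. \<bar>real_of_int (m' i - m i)\<bar>"] dist[OF that] by simp
    finally show ?thesis using \<open>\<epsilon> \<ge> 0\<close> by (simp add: mult_left_mono)
  qed
  let ?U = "\<Union>m'\<in>K. grid_cell h m'"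
  have U: "?U = \<Union>{grid_cell h m' | m'. grid_cell h m' \<subseteq> Q}" by (auto simp: K_def)
  have "?U \<in> lmeasurable" using K cell by auto
  note rest = interior_grid_cells_measure[OF Q h U this]
  show ?thesis
  proof (rule density_average[OF A _ _ K _ _ _ _ close _ _ _ rest])
    show "Q \<in> lmeasurable" "measure lebesgue Q > 0"
      using all_cubes_lmeasurable[OF Q] all_cubes_measure[OF Q] l by auto
    show "pairwise (\<lambda>i j. disjnt (grid_cell h i) (grid_cell h j)) K"
      using h by (auto simp: pairwise_def disjnt_def mem_grid_cell_iff)
    show "0 \<le> \<epsilon> * (CARD('n) * (CARD('n) * l / h + 1))"
      using \<open>\<epsilon> \<ge> 0\<close> l h by simp
    show "density_in A (grid_cell h m) \<le> 1" "0 \<le> density_in A (grid_cell h m)"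
      using density_in_le_1[OF A cell(1)] density_in_nonneg by auto
    show "grid_cell h m' \<subseteq> Q" if "m' \<in> K" for m'
      using that by (simp add: K_def)
  qed (use cell in simp_all)
qed

section \<open>Choice of the dyadic scale and conclusion\<close>

lemma ex_dyadic_between:
  fixes t :: real
  assumes "t > 0"
  obtains k :: int where "2 powi (- k) \<le> t" "t < 2 * 2 powi (- k)"
proof
  define j where "j = \<lfloor>log 2 t\<rfloor>"
  have j: "of_int j \<le> log 2 t" "log 2 t < of_int j + 1" by (auto simp: j_def)
  have pw: "2 powi (- (- j)) = (2::real) powr of_int j" by (simp add: powr_real_of_int')
  show "2 powi (- (- j)) \<le> t"
    unfolding pw using j(1) assms by (simp add: le_log_iff)
  show "t < 2 * 2 powi (- (- j))"
    unfolding pw using j(2) assms by (simp add: log_less_iff powr_add)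
qed

text \<open>The order of choices matters: \<open>M\<close> makes the boundary error small, then
  \<open>\<epsilon>'\<close> makes chains of length of order \<open>M\<close> harmless, and only
  then does the dyadic condition supply \<open>\<delta>\<close>.\<close>

lemma dyadic_imp_all_cubes:
  fixes A :: "(real ^ 'n) set"
  assumes A: "A \<in> sets lebesgue"
    and dyadic: "\<And>\<epsilon>. \<epsilon> > 0 \<Longrightarrow> \<exists>\<delta>>0. \<forall>l<\<delta>. \<forall>Q\<in>dyadic_cubes l. \<forall>Q'\<in>dyadic_cubes l.
             consecutive Q Q' \<longrightarrow> \<bar>density_in A Q - density_in A Q'\<bar> \<le> \<epsilon>"
    and "\<epsilon> > 0"
  shows "\<exists>\<delta>>0. \<forall>l<\<delta>. \<forall>Q\<in>all_cubes l. \<forall>Q'\<in>all_cubes l.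
             consecutive Q Q' \<longrightarrow> \<bar>density_in A Q - density_in A Q'\<bar> \<le> \<epsilon>"
proof -
  define n where "n = real CARD('n)"
  have n: "n \<ge> 1" by (simp add: n_def Suc_leI)
  \<comment> \<open>The first summand makes the boundary error at most
    \<open>\<epsilon> / 4\<close>; the second ensures \<open>2 * n * h \<le> l\<close>.\<close>
  define M where "M = 8 * n^2 / \<epsilon> + 2 * n"
  have M: "M \<ge> 2 * n" "8 * n^2 / \<epsilon> \<le> M"
    using n \<open>\<epsilon> > 0\<close> by (auto simp: M_def)
  then have M: "M \<ge> 2 * n" "M \<ge> 1" "2 * n^2 / M \<le> \<epsilon> / 4"
    using n \<open>\<epsilon> > 0\<close> by (auto simp: field_simps)
  \<comment> \<open>The denominator bounds the chain length when
    \<open>l / h \<le> 2 * M\<close>.\<close>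
  define \<epsilon>' where "\<epsilon>' = (\<epsilon> / 4) / (n * (n * (2 * M) + 1))"
  have "\<epsilon>' > 0" using n M \<open>\<epsilon> > 0\<close> by (auto simp: \<epsilon>'_def intro!: divide_pos_pos mult_pos_pos add_pos_pos)
  then obtain \<delta> where \<delta>: "\<delta> > 0" and small: "\<And>l Q Q'. l < \<delta> \<Longrightarrow> Q \<in> dyadic_cubes l \<Longrightarrow>
      Q' \<in> dyadic_cubes l \<Longrightarrow> consecutive Q Q' \<Longrightarrow> \<bar>density_in A Q - density_in A Q'\<bar> \<le> \<epsilon>'"
    using dyadic by meson
  have "\<bar>density_in A Q - density_in A Q'\<bar> \<le> \<epsilon>"
    if l\<delta>: "l < \<delta>" and Q: "Q \<in> all_cubes l" "Q' \<in> all_cubes l" and cons: "consecutive Q Q'" for l Q Q'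
  proof -
    have l: "l > 0" using all_cubesE[OF Q(1)] by blast
    \<comment> \<open>Rounding \<open>l / M\<close> down to a power of two keeps
      \<open>l / h\<close> between \<open>M\<close> and \<open>2 * M\<close>: the lower bound
      controls the boundary error, the upper one the chains.\<close>
    obtain k :: int where k: "2 powi (- k) \<le> l / M" "l / M < 2 * 2 powi (- k)"
      using ex_dyadic_between[of "l / M"] l M by auto
    define h :: real where "h = 2 powi (- k)"
    have h: "h > 0" "h \<le> l / M" "l / M < 2 * h" using k by (auto simp: h_def)
    then have "M * h \<le> l" "l \<le> 2 * M * h" using M(2) by (simp_all add: field_simps)
    with h(1) have hM: "M * h \<le> l" "l / h \<le> 2 * M" by (simp_all add: pos_divide_le_eq)
    have "h \<le> M * h" "2 * n * h \<le> M * h" using M h by (auto intro: mult_right_mono)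
    then have "h < \<delta>" and 2: "2 * n * h \<le> l" using hM l\<delta> by auto
    have step: "\<bar>density_in A (grid_cell h m) - density_in A (grid_cell h (m(i := m i + 1)))\<bar> \<le> \<epsilon>'" for m i
      by (rule small[OF \<open>h < \<delta>\<close> _ _ consecutive_grid_cell[OF h(1)]])
        (auto simp: dyadic_cubes_eq h_def)
    \<comment> \<open>A facet is nonempty by definition, so the closures have a common
      point.\<close>
    obtain z where z: "z \<in> closure Q" "z \<in> closure Q'"
      using cons by (fastforce simp: consecutive_def facet_of_def)
    define m where "m = (\<lambda>i. \<lfloor>z $ i / h\<rfloor>)"
    have zm: "z \<in> grid_cell h m" using h by (simp add: mem_grid_cell_iff m_def)
    have "\<epsilon>' * (n * (n * l / h + 1)) \<le> \<epsilon>' * (n * (n * (2 * M) + 1))"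
      using hM n \<open>\<epsilon>' > 0\<close> mult_left_mono[OF hM(2), of n] by (intro mult_left_mono add_mono) auto
    also have "\<dots> = \<epsilon> / 4"
      using n M by (simp add: \<epsilon>'_def add_pos_pos less_imp_neq[symmetric])
    finally have b1: "\<epsilon>' * (n * (n * l / h + 1)) \<le> \<epsilon> / 4" .
    have "2 * n^2 * h / l = 2 * n^2 * (h / l)" by simp
    also have "\<dots> \<le> 2 * n^2 * (1 / M)"
      using h M l by (intro mult_left_mono) (auto simp: field_simps)
    finally have b2: "2 * n^2 * h / l \<le> \<epsilon> / 4" using M by simp
    have near: "\<bar>density_in A R - density_in A (grid_cell h m)\<bar> \<le> \<epsilon> / 2"
      if "R \<in> all_cubes l" "z \<in> closure R" for R
    proof -
      have "\<bar>density_in A R - density_in A (grid_cell h m)\<bar>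
          \<le> \<epsilon>' * (n * (n * l / h + 1)) + 2 * n^2 * h / l"
        using density_near_grid_cell[OF A h(1) _ less_imp_le[OF \<open>\<epsilon>' > 0\<close>] step that zm] 2
        by (simp add: n_def)
      then show ?thesis using b1 b2 by linarith
    qed
    show ?thesis using near[OF Q(1) z(1)] near[OF Q(2) z(2)] by linarith
  qed
  with \<open>\<delta> > 0\<close> show ?thesis by blast
qed

theorem corollary2:
  fixes A :: "(real ^ 'n) set"
  assumes "A \<in> sets lebesgue"
  shows "((\<forall>\<epsilon>>0. \<exists>\<delta>>0. \<forall>l<\<delta>. \<forall>Q\<in>dyadic_cubes l. \<forall>Q'\<in>dyadic_cubes l.
             consecutive Q Q' \<longrightarrow> \<bar>density_in A Q - density_in A Q'\<bar> \<le> \<epsilon>)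
          \<longleftrightarrow> smooth_set A)
    \<and> ((\<forall>\<epsilon>>0. \<exists>\<delta>>0. \<forall>l<\<delta>. \<forall>Q\<in>all_cubes l. \<forall>Q'\<in>all_cubes l.
             consecutive Q Q' \<longrightarrow> \<bar>density_in A Q - density_in A Q'\<bar> \<le> \<epsilon>)
          \<longleftrightarrow> smooth_set A)"
    (is "(?a \<longleftrightarrow> _) \<and> (?b \<longleftrightarrow> _)")
proof -
  let ?close = "\<lambda>C. \<forall>\<epsilon>>0. \<exists>\<delta>>0. \<forall>l<\<delta>. \<forall>Q\<in>C l. \<forall>Q'\<in>C l.
    consecutive Q Q' \<longrightarrow> \<bar>density_in A Q - density_in A Q'\<bar> \<le> \<epsilon>"
  \<comment> \<open>The condition passes to smaller families of cubes. As dyadic cubes are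
    axis-parallel and these are among all cubes, (b) implies (c) and (c) implies (a).\<close>
  have mono: "?close C" if "?close C'" "\<And>l. C l \<subseteq> C' l" for C C' :: "real \<Rightarrow> (real^'n) set set"
  proof (intro allI impI)
    fix \<epsilon> :: real assume "\<epsilon> > 0"
    then obtain \<delta> where "\<delta> > 0" and \<delta>: "\<And>l Q Q'. l < \<delta> \<Longrightarrow> Q \<in> C' l \<Longrightarrow> Q' \<in> C' l \<Longrightarrow>
        consecutive Q Q' \<Longrightarrow> \<bar>density_in A Q - density_in A Q'\<bar> \<le> \<epsilon>"
      using \<open>?close C'\<close>[rule_format, OF \<open>\<epsilon> > 0\<close>] by blast
    show "\<exists>\<delta>>0. \<forall>l<\<delta>. \<forall>Q\<in>C l. \<forall>Q'\<in>C l.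
        consecutive Q Q' \<longrightarrow> \<bar>density_in A Q - density_in A Q'\<bar> \<le> \<epsilon>"
      using \<open>\<delta> > 0\<close> \<delta> that(2) by blast
  qed
  have "?a \<Longrightarrow> ?b"
    using dyadic_imp_all_cubes[OF assms] by blast
  moreover have "?b \<Longrightarrow> ?close axis_cubes"
    by (rule mono[OF _ axis_subset_all_cubes])
  moreover have "?close axis_cubes \<Longrightarrow> ?a"
    by (rule mono[OF _ dyadic_subset_axis_cubes])
  ultimately show ?thesis
    unfolding smooth_set_iff[OF assms] by argo
qed

end
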